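(* Let $(Q,\diamond)$ be a rack and let $\mathcal{A}:Q\rightarrow Q$ be an averaging operator on $Q$. Then $(Q,\diamond,\diamond_{\mathcal{A}})$ is a rack-pairing, where $x\diamond_{\mathcal{A}}y := \mathcal{A}(x)\diamond y$ for $x,y\in Q$. More generally, for any $k,l\geq 0$, the triple $(Q,\diamond_{\mathcal{A}^k},\diamond_{\mathcal{A}^{k+l}})$ is a rack-pairing, where $x\diamond_{\mathcal{A}^m}y := \mathcal{A}^m(x)\diamond y$ for $m\geq 0$.
   Context: A (left) rack $(Q,\diamond)$ is a nonempty set $Q$ with a binary operation $\diamond$ such that $x\diamond(y\diamond z) = (x\diamond y)\diamond(x\diamond z)$ for all $x,y,z\in Q$, and for any $x,y\in Q$ there is a unique $c\in Q$ with $x\diamond c = y$. An averaging operator on a rack $(Q,\diamond)$ is a map $\mathcal{A}:Q\to Q$ satisfying $\mathcal{A}(x)\diamond\mathcal{A}(y) = \mathcal{A}(\mathcal{A}(x)\diamond y)$ for all $x,y\in Q$. $\mathcal{A}^m$ is the $m$-fold composition, $\mathcal{A}^0=\mathrm{Id}$. A (left) rack-pairing is a triple $(Q,\diamond,\star)$ such that $(Q,\diamond)$ and $(Q,\star)$ are both (left) racks and $x\star(y\diamond z) = (x\star y)\diamond(x\star z)$ for all $x,y,z\in Q$. *)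

theory Defs
  imports Main "HOL-Library.FuncSet"
begin

locale rack =
  fixes Q :: "'a set" and rop :: "'a \<Rightarrow> 'a \<Rightarrow> 'a" (infixl "\<diamond>" 70)
  assumes nonempty: "Q \<noteq> {}"
    and closed: "\<lbrakk>x \<in> Q; y \<in> Q\<rbrakk> \<Longrightarrow> x \<diamond> y \<in> Q"
    and self_distrib:
      "\<lbrakk>x \<in> Q; y \<in> Q; z \<in> Q\<rbrakk> \<Longrightarrow> x \<diamond> (y \<diamond> z) = (x \<diamond> y) \<diamond> (x \<diamond> z)"
    and left_div: "\<lbrakk>x \<in> Q; y \<in> Q\<rbrakk> \<Longrightarrow> \<exists>!c. c \<in> Q \<and> x \<diamond> c = y"

locale averaging_operator = rack +
  fixes A :: "'a \<Rightarrow> 'a"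
  assumes maps: "A \<in> Q \<rightarrow> Q"
    and averaging: "\<lbrakk>x \<in> Q; y \<in> Q\<rbrakk> \<Longrightarrow> A x \<diamond> A y = A (A x \<diamond> y)"

locale rack_pairing =
  first: rack Q rop + second: rack Q sop
  for Q :: "'a set"
    and rop :: "'a \<Rightarrow> 'a \<Rightarrow> 'a" (infixl "\<diamond>" 70)
    and sop :: "'a \<Rightarrow> 'a \<Rightarrow> 'a" (infixl "\<star>" 70) +
  assumes pairing_distrib:
    "\<lbrakk>x \<in> Q; y \<in> Q; z \<in> Q\<rbrakk> \<Longrightarrow> x \<star> (y \<diamond> z) = (x \<star> y) \<diamond> (x \<star> z)"

definition twist :: "('a \<Rightarrow> 'a \<Rightarrow> 'a) \<Rightarrow> ('a \<Rightarrow> 'a) \<Rightarrow> 'a \<Rightarrow> 'a \<Rightarrow> 'a"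
  where "twist rop A x y = rop (A x) y"

end

theory Submission
  imports Defs
begin

text \<open>
  The averaging identity says that left translation by an element of the image of \<open>A\<close> commutes
  with \<open>A\<close>, hence with every \<open>A\<^sup>k\<close>. So \<open>A\<^sup>k (A\<^sup>k\<^sup>+\<^sup>l x \<diamond> y) = A\<^sup>k\<^sup>+\<^sup>l x \<diamond> A\<^sup>k y\<close>, which turns
  self-distributivity of \<open>\<diamond>\<close> into the pairing identity; the case \<open>l = 0\<close> shows that
  each twisted operation is a rack, and \<open>k = 0\<close>, \<open>l = 1\<close> is the first claim.
\<close>

context averaging_operator
begin

lemma funpow_closed: "x \<in> Q \<Longrightarrow> (A ^^ k) x \<in> Q"
  using maps by (induction k) auto

lemma funpow_left_translation:
  assumes "x \<in> Q" "y \<in> Q"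
  shows "(A ^^ k) (A x \<diamond> y) = A x \<diamond> (A ^^ k) y"
  using assms by (induction k) (auto simp: averaging funpow_closed)

lemma funpow_averaging:
  assumes x: "x \<in> Q" and y: "y \<in> Q"
  shows "(A ^^ k) ((A ^^ (k + l)) x \<diamond> y) = (A ^^ (k + l)) x \<diamond> (A ^^ k) y"
\<comment> \<open>For \<open>k > 0\<close> the left factor lies in the image of \<open>A\<close>, so
  it can be pulled out of \<open>A ^^ k\<close>. For \<open>k = l = 0\<close> it is just
  \<open>x\<close>, which need not lie there, but then the outer power is the identity.\<close>
proof (cases k)
  case (Suc n)
  then have "(A ^^ (k + l)) x = A ((A ^^ (n + l)) x)" by simp
  then show ?thesis using funpow_left_translation[OF funpow_closed[OF x] y] by metis
qed simp

lemma twist_distrib: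
  assumes "x \<in> Q" "y \<in> Q" "z \<in> Q"
  shows "twist rop (A ^^ (k + l)) x (twist rop (A ^^ k) y z) =
    twist rop (A ^^ k) (twist rop (A ^^ (k + l)) x y) (twist rop (A ^^ (k + l)) x z)"
  \<comment> \<open>With a = \<open>(A ^^ (k + l)) x\<close>, self-distributivity is applied to a,
    \<open>(A ^^ k) y\<close> and \<open>z\<close>.\<close>
  unfolding twist_def
  using assms by (simp only: funpow_averaging funpow_closed self_distrib)

lemma rack_twist: "rack Q (twist rop (A ^^ k))"
proof
  show "twist rop (A ^^ k) x (twist rop (A ^^ k) y z) =
      twist rop (A ^^ k) (twist rop (A ^^ k) x y) (twist rop (A ^^ k) x z)"
    if "x \<in> Q" "y \<in> Q" "z \<in> Q" for x y z
    using twist_distrib[OF that, of k 0] by simp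
\<comment> \<open>Twisted left division by \<open>x\<close> is the original left division by
  \<open>(A ^^ k) x\<close>, again an element of \<open>Q\<close>.\<close>
qed (use nonempty in \<open>simp_all add: twist_def closed left_div funpow_closed\<close>)

lemma rack_pairing_twist:
  "rack_pairing Q (twist rop (A ^^ k)) (twist rop (A ^^ (k + l)))"
  by (intro rack_pairing.intro rack_pairing_axioms.intro rack_twist twist_distrib)

end

theorem proposition4p9:
  fixes Q :: "'a set" and rop :: "'a \<Rightarrow> 'a \<Rightarrow> 'a" and A :: "'a \<Rightarrow> 'a"
  assumes "rack Q rop"
    and "averaging_operator Q rop A"
  shows "rack_pairing Q rop (twist rop A) \<and>
    (\<forall>k l :: nat. rack_pairing Q (twist rop (A ^^ k)) (twist rop (A ^^ (k + l))))"
proof -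
  note pairing = averaging_operator.rack_pairing_twist[OF assms(2)]
  have "twist rop (A ^^ 0) = rop" by (simp add: twist_def fun_eq_iff)
  then have "rack_pairing Q rop (twist rop A)" using pairing[of 0 1] by simp
  with pairing show ?thesis by blast
qed

end
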